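(* Let $H\in\mathrm{GL}_3(\mathbb{C})$ be a hermitian matrix and let $SU_3(H)=\{g\in \mathrm{SL}_3(\mathbb{C})\mid \bar g' H g=H\}$ be the associated special unitary group. Let $R\in SU_3(H)$ be a reflection. Then $R$ is not contained in any global division algebra $(D,\alpha)$ of degree three with involution $\alpha$ of the second kind such that $SU(D_v)\cong SU_3(H)$ for some infinite place $v$. That is: for every quadratic extension $E/F$ of number fields, every central division algebra $D$ of degree three over $E$ with an involution $\alpha$ of the second kind (with respect to $E/F$), every infinite place $v$ of $F$ and every isomorphism $\varphi: SU(D_v)\to SU_3(H)$, one has $R\notin\varphi(SU(D))$. Similarly, no hermitian or skew-hermitian element of $SU_3(H)$ other than the identity arises in this way, i.e. lies in such an image $\varphi(SU(D))$.
   Context: $\bar g'$ denotes the conjugate transpose of $g$. Let $\tau$ be the non-trivial element of $\mathrm{Gal}(E/F)$. An involution of the second kind on $D$ is a ring anti-automorphism $\alpha$ of $D$ with $\alpha\circ\alpha=\mathrm{id}$ and $\alpha|_E=\tau$. Put $SU(D)=\{g\in D^\times\mid\alpha(g)g=1,\ \mathrm{N}_{rd}(g)=1\}$, where $\mathrm{N}_{rd}$ is the reduced norm. For a place $v$ of $F$ put $D_v=D\otimes_F F_v$ with the involution induced by $\alpha$, and let $SU(D_v)$ be the group of $g\in D_v^\times$ with $\alpha(g)g=1$ and reduced norm $1$; $SU(D)$ is regarded as a subgroup of $SU(D_v)$. A reflection is an element $R\ne 1$ with $R^2=1$. An element $g\in SU_3(H)$ is hermitian (respectively skew-hermitian) if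 $g^*=g$ (respectively $g^*=-g$), where $g^*=H^{-1}\bar g'H$ is the adjoint involution attached to $H$. *)

theory Defs
  imports
    "HOL-Analysis.Analysis"
    "HOL-Library.Poly_Mapping"
    "HOL-Algebra.QuotRing"
    "HOL-Algebra.Generated_Groups"
    "HOL-Algebra.Algebraic_Closure_Type"
begin

section \<open>The special unitary group of a hermitian matrix\<close>

definition conj_transpose :: "complex^3^3 \<Rightarrow> complex^3^3" where
  "conj_transpose g = (\<chi> i j. cnj (g $ j $ i))"

definition hermitian_matrix :: "complex^3^3 \<Rightarrow> bool" where
  "hermitian_matrix H \<longleftrightarrow> conj_transpose H = H"

definition SU3 :: "complex^3^3 \<Rightarrow> (complex^3^3) monoid" where
  "SU3 H = \<lparr> carrier = {g. det g = 1 \<and> conj_transpose g ** H ** g = H},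
             monoid.mult = (**), one = mat 1 \<rparr>"

definition adjoint_involution :: "complex^3^3 \<Rightarrow> complex^3^3 \<Rightarrow> complex^3^3" where
  "adjoint_involution H g = matrix_inv H ** conj_transpose g ** H"

definition is_reflection :: "complex^3^3 \<Rightarrow> bool" where
  "is_reflection R \<longleftrightarrow> R \<noteq> mat 1 \<and> R ** R = mat 1"


section \<open>Quadratic extensions of number fields\<close>

text \<open>Fields and division rings are types; an extension is given by its (unital, hence
  injective) structure homomorphism.\<close>

definition type_hom :: "('a::ring_1 \<Rightarrow> 'b::ring_1) \<Rightarrow> bool" where
  "type_hom f \<longleftrightarrow> f \<in> ring_hom ring_of_type_algebra ring_of_type_algebra"

definition number_field :: "'a::field_char_0 itself \<Rightarrow> bool" where
  "number_field _ \<longleftrightarrow>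
     (\<exists>B::'a set. finite B \<and> module.span (\<lambda>(q::rat) x. of_rat q * x) B = UNIV)"

text \<open>The library's dimension is \<open>0\<close> on infinite-dimensional spaces, so a positive value of it
  includes finite-dimensionality.\<close>

definition ext_degree :: "('a::field \<Rightarrow> 'b::ring_1) \<Rightarrow> nat" where
  "ext_degree f = vector_space.dim (\<lambda>c x. f c * x) UNIV"

definition quadratic_extension :: "('f::field \<Rightarrow> 'e::field) \<Rightarrow> bool" where
  "quadratic_extension \<iota> \<longleftrightarrow> type_hom \<iota> \<and> ext_degree \<iota> = 2"

definition Gal :: "('f::field \<Rightarrow> 'e::field) \<Rightarrow> ('e \<Rightarrow> 'e) set" where
  "Gal \<iota> = {\<sigma>. type_hom \<sigma> \<and> bij \<sigma> \<and> (\<forall>x. \<sigma> (\<iota> x) = \<iota> x)}"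


section \<open>Division algebras with involution of the second kind\<close>

definition central_division_algebra :: "nat \<Rightarrow> ('e::field \<Rightarrow> 'd::division_ring) \<Rightarrow> bool" where
  "central_division_algebra n \<kappa> \<longleftrightarrow>
     type_hom \<kappa> \<and> range \<kappa> = {z. \<forall>x. z * x = x * z} \<and> ext_degree \<kappa> = n\<^sup>2"

definition involution_second_kind ::
    "('f::field \<Rightarrow> 'e::field) \<Rightarrow> ('e \<Rightarrow> 'd::division_ring) \<Rightarrow> ('d \<Rightarrow> 'd) \<Rightarrow> bool" where
  "involution_second_kind \<iota> \<kappa> \<alpha> \<longleftrightarrow>
     \<alpha> 1 = 1 \<and> (\<forall>x y. \<alpha> (x + y) = \<alpha> x + \<alpha> y) \<and> (\<forall>x y. \<alpha> (x * y) = \<alpha> y * \<alpha> x) \<and>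
     \<alpha> \<circ> \<alpha> = id \<and>
     (\<exists>\<tau> \<in> Gal \<iota>. \<tau> \<noteq> id \<and> (\<forall>x. \<alpha> (\<kappa> x) = \<kappa> (\<tau> x)))"


section \<open>Tensor products of algebras\<close>

type_synonym ('a, 'b) formal_sum = "('a \<times> 'b) \<Rightarrow>\<^sub>0 int"
type_synonym ('a, 'b) tensor = "('a, 'b) formal_sum set"

text \<open>The monoid ring over the integers of the multiplicative monoid of \<open>A \<times> B\<close>.\<close>

definition pair_ring :: "('a::ring_1, 'b::ring_1) formal_sum ring" where
  "pair_ring =
     \<lparr> carrier = UNIV,
       monoid.mult = (\<lambda>p q. frag_extend (\<lambda>(a, b).
                        frag_extend (\<lambda>(a', b'). frag_of (a * a', b * b')) q) p),
       one = frag_of (1, 1),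
       ring.zero = 0,
       add = (+) \<rparr>"

text \<open>The relations of \<open>A \<otimes>\<^sub>C B\<close>, where \<open>A\<close> and \<open>B\<close> are algebras over the commutative
  ring \<open>C\<close> via \<open>f\<close> and \<open>g\<close>, whose images are meant to be central. The subgroup they
  generate is then an ideal of the monoid ring, because products of a defining relation with
  a pair are again defining relations.\<close>

definition tensor_relators ::
    "('c \<Rightarrow> 'a::ring_1) \<Rightarrow> ('c \<Rightarrow> 'b::ring_1) \<Rightarrow> ('a, 'b) formal_sum set" where
  "tensor_relators f g =
     {frag_of (a + a', b) - frag_of (a, b) - frag_of (a', b) | a a' b. True} \<union>
     {frag_of (a, b + b') - frag_of (a, b) - frag_of (a, b') | a b b'. True} \<union>
     {frag_of (a * f c, b) - frag_of (a, g c * b) | a b c. True}"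

definition tensor_relations ::
    "('c \<Rightarrow> 'a::ring_1) \<Rightarrow> ('c \<Rightarrow> 'b::ring_1) \<Rightarrow> ('a, 'b) formal_sum set" where
  "tensor_relations f g = generate (add_monoid pair_ring) (tensor_relators f g)"

definition tensor_ring ::
    "('c \<Rightarrow> 'a::ring_1) \<Rightarrow> ('c \<Rightarrow> 'b::ring_1) \<Rightarrow> ('a, 'b) tensor ring" where
  "tensor_ring f g = pair_ring Quot (tensor_relations f g)"

definition pure_tensor ::
    "('c \<Rightarrow> 'a::ring_1) \<Rightarrow> ('c \<Rightarrow> 'b::ring_1) \<Rightarrow> 'a \<Rightarrow> 'b \<Rightarrow> ('a, 'b) tensor" where
  "pure_tensor f g a b = tensor_relations f g +>\<^bsub>pair_ring\<^esub> frag_of (a, b)"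

text \<open>The map \<open>u \<otimes> id : A \<otimes>\<^sub>C B \<rightarrow> A' \<otimes>\<^sub>C B\<close> for a \<open>C\<close>-linear map \<open>u : A \<rightarrow> A'\<close>, where
  \<open>f\<close> and \<open>f'\<close> are the structure maps of \<open>A\<close> and \<open>A'\<close>. The union is over representatives
  of the class \<open>t\<close>; all of them give the same class.\<close>

definition tensor_map ::
    "('c \<Rightarrow> 'a'::ring_1) \<Rightarrow> ('c \<Rightarrow> 'b::ring_1) \<Rightarrow> ('a::ring_1 \<Rightarrow> 'a') \<Rightarrow>
     ('a, 'b) tensor \<Rightarrow> ('a', 'b) tensor" where
  "tensor_map f' g u t =
     (\<Union>p\<in>t. tensor_relations f' g +>\<^bsub>pair_ring\<^esub> frag_extend (\<lambda>(a, b). frag_of (u a, b)) p)"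


section \<open>Reduced norms\<close>

definition mat_ring :: "('a::comm_ring_1^3^3) ring" where
  "mat_ring = \<lparr> carrier = UNIV, monoid.mult = (**), one = mat 1, ring.zero = 0, add = (+) \<rparr>"

text \<open>An isomorphism \<open>D \<otimes>\<^sub>E \<Omega> \<cong> M\<^sub>3(\<Omega>)\<close> of \<open>\<Omega>\<close>-algebras, \<open>\<Omega>\<close> the algebraic closure of \<open>E\<close>.\<close>

definition splitting ::
    "('e::field \<Rightarrow> 'd::division_ring) \<Rightarrow>
     (('d, 'e alg_closure) tensor \<Rightarrow> 'e alg_closure^3^3) \<Rightarrow> bool" where
  "splitting \<kappa> h \<longleftrightarrow>
     h \<in> ring_iso (tensor_ring \<kappa> to_ac) mat_ring \<and>
     (\<forall>c. h (pure_tensor \<kappa> to_ac 1 c) = mat c)"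

definition split_rep ::
    "('e::field \<Rightarrow> 'd::division_ring) \<Rightarrow>
     (('d, 'e alg_closure) tensor \<Rightarrow> 'e alg_closure^3^3) \<Rightarrow>
     'd \<Rightarrow> 'e alg_closure^3^3" where
  "split_rep \<kappa> h d = h (pure_tensor \<kappa> to_ac d 1)"

text \<open>\<open>z\<close> is the reduced norm of \<open>d\<close>. By the Skolem--Noether theorem the determinant
  does not depend on the splitting \<open>h\<close>.\<close>

definition has_reduced_norm :: "('e::field \<Rightarrow> 'd::division_ring) \<Rightarrow> 'd \<Rightarrow> 'e \<Rightarrow> bool" where
  "has_reduced_norm \<kappa> d z \<longleftrightarrow> (\<exists>h. splitting \<kappa> h \<and> det (split_rep \<kappa> h d) = to_ac z)"

text \<open>The Leibniz formula, as in the library definition of \<^const>\<open>det\<close>, for entries in a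
  commutative ring given by a carrier.\<close>

definition ring_det :: "('a, 'm) ring_scheme \<Rightarrow> (3 \<Rightarrow> 3 \<Rightarrow> 'a) \<Rightarrow> 'a" where
  "ring_det R A =
     finsum R (\<lambda>p. add_pow R (sign p) (finprod R (\<lambda>i. A i (p i)) UNIV)) {p. p permutes UNIV}"

text \<open>\<open>z \<in> E \<otimes>\<^sub>F K\<close> is the reduced norm of \<open>x \<in> D \<otimes>\<^sub>F K = D \<otimes>\<^sub>E (E \<otimes>\<^sub>F K)\<close>, where
  \<open>j : F \<rightarrow> K\<close> is a field extension. A splitting of \<open>D\<close> over \<open>\<Omega>\<close> induces a map
  \<open>D \<otimes>\<^sub>F K \<rightarrow> M\<^sub>3(\<Omega>) \<otimes>\<^sub>F K = M\<^sub>3(\<Omega> \<otimes>\<^sub>F K)\<close>, a splitting of \<open>D \<otimes>\<^sub>F K\<close> over the faithfully flat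
  extension \<open>\<Omega> \<otimes>\<^sub>F K\<close> of \<open>E \<otimes>\<^sub>F K\<close>; the determinant of the image of \<open>x\<close> is
  the image of the reduced norm.\<close>

definition has_local_reduced_norm ::
    "('f::field \<Rightarrow> 'e::field) \<Rightarrow> ('e \<Rightarrow> 'd::division_ring) \<Rightarrow> ('f \<Rightarrow> 'k::field) \<Rightarrow>
     ('d, 'k) tensor \<Rightarrow> ('e, 'k) tensor \<Rightarrow> bool" where
  "has_local_reduced_norm \<iota> \<kappa> j x z \<longleftrightarrow>
     (\<exists>h. splitting \<kappa> h \<and>
        ring_det (tensor_ring (to_ac \<circ> \<iota>) j)
          (\<lambda>r s. tensor_map (to_ac \<circ> \<iota>) j (\<lambda>d. split_rep \<kappa> h d $ r $ s) x)
        = tensor_map (to_ac \<circ> \<iota>) j to_ac z)"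


section \<open>The global and local unitary groups\<close>

definition SU_global :: "('e::field \<Rightarrow> 'd::division_ring) \<Rightarrow> ('d \<Rightarrow> 'd) \<Rightarrow> 'd set" where
  "SU_global \<kappa> \<alpha> = {g. g \<noteq> 0 \<and> \<alpha> g * g = 1 \<and> has_reduced_norm \<kappa> g 1}"

definition local_algebra ::
    "('f::field \<Rightarrow> 'e::field) \<Rightarrow> ('e \<Rightarrow> 'd::division_ring) \<Rightarrow> ('f \<Rightarrow> 'k::field) \<Rightarrow>
     ('d, 'k) tensor ring" where
  "local_algebra \<iota> \<kappa> j = tensor_ring (\<kappa> \<circ> \<iota>) j"

definition local_involution ::
    "('f::field \<Rightarrow> 'e::field) \<Rightarrow> ('e \<Rightarrow> 'd::division_ring) \<Rightarrow> ('d \<Rightarrow> 'd) \<Rightarrow> ('f \<Rightarrow> 'k::field) \<Rightarrow>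
     ('d, 'k) tensor \<Rightarrow> ('d, 'k) tensor" where
  "local_involution \<iota> \<kappa> \<alpha> j = tensor_map (\<kappa> \<circ> \<iota>) j \<alpha>"

definition SU_local ::
    "('f::field \<Rightarrow> 'e::field) \<Rightarrow> ('e \<Rightarrow> 'd::division_ring) \<Rightarrow> ('d \<Rightarrow> 'd) \<Rightarrow> ('f \<Rightarrow> 'k::field) \<Rightarrow>
     ('d, 'k) tensor monoid" where
  "SU_local \<iota> \<kappa> \<alpha> j =
     \<lparr> carrier = {x \<in> Units (local_algebra \<iota> \<kappa> j).
                   local_involution \<iota> \<kappa> \<alpha> j x \<otimes>\<^bsub>local_algebra \<iota> \<kappa> j\<^esub> x = \<one>\<^bsub>local_algebra \<iota> \<kappa> j\<^esub> \<and>
                   has_local_reduced_norm \<iota> \<kappa> j x \<one>\<^bsub>tensor_ring \<iota> j\<^esub>},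
       monoid.mult = monoid.mult (local_algebra \<iota> \<kappa> j),
       one = \<one>\<^bsub>local_algebra \<iota> \<kappa> j\<^esub> \<rparr>"

definition SU_global_in_local ::
    "('f::field \<Rightarrow> 'e::field) \<Rightarrow> ('e \<Rightarrow> 'd::division_ring) \<Rightarrow> ('d \<Rightarrow> 'd) \<Rightarrow> ('f \<Rightarrow> 'k::field) \<Rightarrow>
     ('d, 'k) tensor set" where
  "SU_global_in_local \<iota> \<kappa> \<alpha> j = (\<lambda>g. pure_tensor (\<kappa> \<circ> \<iota>) j g 1) ` SU_global \<kappa> \<alpha>"


section \<open>Infinite places and completions\<close>

definition absolute_value :: "('a::field \<Rightarrow> real) \<Rightarrow> bool" where
  "absolute_value v \<longleftrightarrow>
     (\<forall>x. 0 \<le> v x) \<and> (\<forall>x. v x = 0 \<longleftrightarrow> x = 0) \<and>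
     (\<forall>x y. v (x * y) = v x * v y) \<and> (\<forall>x y. v (x + y) \<le> v x + v y)"

text \<open>An infinite place is represented by an archimedean absolute value.\<close>

definition represents_infinite_place :: "('a::field \<Rightarrow> real) \<Rightarrow> bool" where
  "represents_infinite_place v \<longleftrightarrow> absolute_value v \<and> (\<exists>n::nat. 1 < v (of_nat n))"

definition is_completion ::
    "('f::field \<Rightarrow> real) \<Rightarrow> ('f \<Rightarrow> 'k::field) \<Rightarrow> ('k \<Rightarrow> real) \<Rightarrow> bool" where
  "is_completion v j w \<longleftrightarrow>
     type_hom j \<and> absolute_value w \<and> (\<forall>x. w (j x) = v x) \<and>
     Metric_space.mcomplete UNIV (\<lambda>x y. w (x - y)) \<and>
     Metric_space.mtopology UNIV (\<lambda>x y. w (x - y)) closure_of range j = UNIV"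

end

theory Submission
  imports Defs
begin

text \<open>If \<open>g \<in> SU(D)\<close> is sent to an element of square \<open>1\<close>, then \<open>g\<^sup>2 = 1\<close>, because \<open>\<phi>\<close> is injective
  on \<open>SU(D\<^sub>v)\<close> and \<open>D \<rightarrow> D\<^sub>v\<close> is injective. As \<open>D\<close> is a division ring, \<open>g = 1\<close> or \<open>g = -1\<close>, and
  \<open>-1\<close> is excluded by its reduced norm \<open>(-1)\<^sup>3 = -1\<close>. Since \<open>g\<^sup>*g = 1\<close> in \<open>SU\<^sub>3(H)\<close>, a hermitian
  element has square \<open>1\<close>, while a skew-hermitian one would have square \<open>-1\<close>, of determinant
  \<open>-1\<close>; so there are none of the latter.\<close>

section \<open>Tensor products\<close>

lemma pair_ring_simps [simp]:
  "carrier pair_ring = UNIV" "\<one>\<^bsub>pair_ring\<^esub> = frag_of (1, 1)" "\<zero>\<^bsub>pair_ring\<^esub> = 0"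
  "p \<oplus>\<^bsub>pair_ring\<^esub> q = p + q"
  by (simp_all add: pair_ring_def)

lemma pair_mult_of [simp]:
  "frag_of (a, b) \<otimes>\<^bsub>pair_ring\<^esub> frag_of (a', b') = frag_of (a * a', b * b')"
  by (simp add: pair_ring_def)

lemma pair_mult_linear [simp]:
  "0 \<otimes>\<^bsub>pair_ring\<^esub> q = 0" "p \<otimes>\<^bsub>pair_ring\<^esub> 0 = 0"
  "(p - p') \<otimes>\<^bsub>pair_ring\<^esub> q = p \<otimes>\<^bsub>pair_ring\<^esub> q - p' \<otimes>\<^bsub>pair_ring\<^esub> q"
  "p \<otimes>\<^bsub>pair_ring\<^esub> (q - q') = p \<otimes>\<^bsub>pair_ring\<^esub> q - p \<otimes>\<^bsub>pair_ring\<^esub> q'"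
  "(p + p') \<otimes>\<^bsub>pair_ring\<^esub> q = p \<otimes>\<^bsub>pair_ring\<^esub> q + p' \<otimes>\<^bsub>pair_ring\<^esub> q"
  "p \<otimes>\<^bsub>pair_ring\<^esub> (q + q') = p \<otimes>\<^bsub>pair_ring\<^esub> q + p \<otimes>\<^bsub>pair_ring\<^esub> q'"
proof -
  \<comment> \<open>The product is \<open>frag_extend (m q) p\<close>, so linearity in
    \<open>p\<close> is that of \<open>frag_extend\<close>; linearity in \<open>q\<close> comes from
    each \<open>m q i\<close> being linear in \<open>q\<close>.\<close>
  define m where "m = (\<lambda>(q :: ('a, 'b) formal_sum) (a, b).
     frag_extend (\<lambda>(a', b'). frag_of (a * a', b * b')) q)"
  have mult: "p \<otimes>\<^bsub>pair_ring\<^esub> q = frag_extend (m q) p" for p q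
    by (simp add: pair_ring_def m_def)
  have m_add: "m (q + q') i = m q i + m q' i" and m_diff: "m (q - q') i = m q i - m q' i"
    and m_0: "m 0 i = 0" for q q' i
    by (simp_all add: m_def frag_extend_add frag_extend_diff split: prod.split)
  have cmul_diff: "frag_cmul k (x - y) = frag_cmul k x - frag_cmul k y"
    for k and x y :: "('a, 'b) formal_sum"
    by (rule poly_mapping_eqI) (simp add: lookup_minus algebra_simps)
  show "0 \<otimes>\<^bsub>pair_ring\<^esub> q = 0" "p \<otimes>\<^bsub>pair_ring\<^esub> 0 = 0"
    "(p - p') \<otimes>\<^bsub>pair_ring\<^esub> q = p \<otimes>\<^bsub>pair_ring\<^esub> q - p' \<otimes>\<^bsub>pair_ring\<^esub> q"
    "(p + p') \<otimes>\<^bsub>pair_ring\<^esub> q = p \<otimes>\<^bsub>pair_ring\<^esub> q + p' \<otimes>\<^bsub>pair_ring\<^esub> q"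
    by (simp_all add: mult frag_extend_add frag_extend_diff m_0 frag_extend_eq_0)
  show "p \<otimes>\<^bsub>pair_ring\<^esub> (q - q') = p \<otimes>\<^bsub>pair_ring\<^esub> q - p \<otimes>\<^bsub>pair_ring\<^esub> q'"
    "p \<otimes>\<^bsub>pair_ring\<^esub> (q + q') = p \<otimes>\<^bsub>pair_ring\<^esub> q + p \<otimes>\<^bsub>pair_ring\<^esub> q'"
    by (simp_all add: mult frag_extend_def m_add m_diff frag_cmul_distrib2 sum.distrib
        sum_subtractf cmul_diff)
qed

text \<open>The pairs generate the free abelian group of formal sums. Identities that are additive
  in every variable thus need checking on pairs only.\<close>

lemma formal_sum_induct [case_names zero of diff]:
  assumes "P 0" "\<And>a b. P (frag_of (a, b))" "\<And>p q. P p \<Longrightarrow> P q \<Longrightarrow> P (p - q)"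
  shows "P p"
  by (rule frag_induction[of p UNIV]) (use assms in auto)

lemma ring_pair_ring: "ring (pair_ring :: ('a::ring_1, 'b::ring_1) formal_sum ring)" (is "ring ?R")
proof (rule ringI)
  show "abelian_group ?R"
  proof (rule abelian_groupI)
    show "\<exists>y\<in>carrier ?R. y \<oplus>\<^bsub>?R\<^esub> x = \<zero>\<^bsub>?R\<^esub>" for x
      by (rule bexI[of _ "- x"]) simp_all
  qed (simp_all add: algebra_simps)
  show "Group.monoid ?R"
  proof (rule monoidI)
    fix x y z :: "('a, 'b) formal_sum"
    show "x \<otimes>\<^bsub>pair_ring\<^esub> y \<otimes>\<^bsub>pair_ring\<^esub> z = x \<otimes>\<^bsub>pair_ring\<^esub> (y \<otimes>\<^bsub>pair_ring\<^esub> z)"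
    proof (induction x rule: formal_sum_induct)
      case (of a b)
      show ?case
      proof (induction y rule: formal_sum_induct)
        case (of a' b')
        show ?case
          by (induction z rule: formal_sum_induct) (simp_all add: mult.assoc)
      qed simp_all
    qed simp_all
    show "\<one>\<^bsub>pair_ring\<^esub> \<otimes>\<^bsub>pair_ring\<^esub> x = x" "x \<otimes>\<^bsub>pair_ring\<^esub> \<one>\<^bsub>pair_ring\<^esub> = x"
      by (induction x rule: formal_sum_induct) simp_all
  qed simp_all
qed simp_all

lemma cring_pair_ring: "cring (pair_ring :: ('a::comm_ring_1, 'b::comm_ring_1) formal_sum ring)"
proof (intro cring.intro comm_monoid.intro comm_monoid_axioms.intro ring_pair_ring)
  show "Group.monoid (pair_ring :: ('a, 'b) formal_sum ring)"
    using ring_pair_ring by (rule ring.axioms)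
  show "x \<otimes>\<^bsub>pair_ring\<^esub> y = y \<otimes>\<^bsub>pair_ring\<^esub> x" for x y :: "('a, 'b) formal_sum"
  proof (induction x rule: formal_sum_induct)
    case (of a b)
    show ?case
      by (induction y rule: formal_sum_induct) (simp_all add: mult.commute)
  qed simp_all
qed

lemma pair_ring_minus [simp]: "\<ominus>\<^bsub>pair_ring\<^esub> p = - p"
proof -
  interpret ring "pair_ring :: ('a, 'b) formal_sum ring" by (rule ring_pair_ring)
  show ?thesis by (rule minus_equality) simp_all
qed

lemma subgroup_pair_ringI:
  fixes S :: "('a::ring_1, 'b::ring_1) formal_sum set"
  assumes "0 \<in> S" "\<And>p q. p \<in> S \<Longrightarrow> q \<in> S \<Longrightarrow> p - q \<in> S"
  shows "subgroup S (add_monoid pair_ring)"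
proof -
  interpret ring "pair_ring :: ('a, 'b) formal_sum ring" by (rule ring_pair_ring)
  have minus: "- p \<in> S" if "p \<in> S" for p
    using assms(2)[OF assms(1) that] by simp
  have "p + q \<in> S" if "p \<in> S" "q \<in> S" for p q
    using assms(2)[OF that(1) minus[OF that(2)]] by simp
  then show ?thesis
    using assms(1) minus pair_ring_minus[where ?'a = 'a and ?'b = 'b]
    by (intro add.subgroupI) (auto simp: a_inv_def)
qed

section \<open>Relations and their cosets\<close>

lemma tensor_relatorsI:
  "frag_of (a + a', b) - frag_of (a, b) - frag_of (a', b) \<in> tensor_relators f g"
  "frag_of (a, b + b') - frag_of (a, b) - frag_of (a, b') \<in> tensor_relators f g"
  "frag_of (a * f c, b) - frag_of (a, g c * b) \<in> tensor_relators f g"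
  unfolding tensor_relators_def by blast+

lemma tensor_relators_cases [consumes 1, case_names left right scalar]:
  assumes "r \<in> tensor_relators f g"
  obtains a a' b where "r = frag_of (a + a', b) - frag_of (a, b) - frag_of (a', b)"
    | a b b' where "r = frag_of (a, b + b') - frag_of (a, b) - frag_of (a, b')"
    | a c b where "r = frag_of (a * f c, b) - frag_of (a, g c * b)"
  using assms unfolding tensor_relators_def by blast

lemma subgroup_tensor_relations: "subgroup (tensor_relations f g) (add_monoid pair_ring)"
proof -
  interpret ring pair_ring by (rule ring_pair_ring)
  show ?thesis
    unfolding tensor_relations_def by (rule add.generate_is_subgroup) simp
qed

text \<open>An additive property of all relations follows from its truth on the relators. This
  serves for the ideal property, for maps induced by linear maps and for the retraction of A -> A
  \<otimes> K.\<close>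

lemma tensor_relations_subset:
  assumes "tensor_relators f g \<subseteq> S" "0 \<in> S" "\<And>p q. p \<in> S \<Longrightarrow> q \<in> S \<Longrightarrow> p - q \<in> S"
  shows "tensor_relations f g \<subseteq> S"
proof -
  interpret ring pair_ring by (rule ring_pair_ring)
  show ?thesis
    unfolding tensor_relations_def
    by (rule add.generate_subgroup_incl[OF assms(1) subgroup_pair_ringI[OF assms(2,3)]])
qed

lemma tensor_relators_subset_relations: "tensor_relators f g \<subseteq> tensor_relations f g"
  by (auto simp: tensor_relations_def intro: generate.incl)

lemma tensor_relations_0 [simp]: "0 \<in> tensor_relations f g"
  using subgroup.one_closed[OF subgroup_tensor_relations] by simp

lemma tensor_relations_minus:
  "p \<in> tensor_relations f g \<Longrightarrow> - p \<in> tensor_relations f g"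
  using subgroup.m_inv_closed[OF subgroup_tensor_relations, of p f g] pair_ring_minus[of p]
  by (simp add: a_inv_def)

lemma tensor_relations_add:
  "p \<in> tensor_relations f g \<Longrightarrow> q \<in> tensor_relations f g \<Longrightarrow> p + q \<in> tensor_relations f g"
  using subgroup.m_closed[OF subgroup_tensor_relations, of p f g q] by simp

lemma tensor_relations_diff:
  "p \<in> tensor_relations f g \<Longrightarrow> q \<in> tensor_relations f g \<Longrightarrow> p - q \<in> tensor_relations f g"
  using tensor_relations_add[OF _ tensor_relations_minus, of p f g q] by simp

lemma mem_tensor_class_iff:
  "x \<in> tensor_relations f g +>\<^bsub>pair_ring\<^esub> p \<longleftrightarrow> x - p \<in> tensor_relations f g"
  by (auto simp: a_r_coset_def' intro!: bexI[of _ "x - p"])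

lemma tensor_class_eq_iff:
  "tensor_relations f g +>\<^bsub>pair_ring\<^esub> p = tensor_relations f g +>\<^bsub>pair_ring\<^esub> q \<longleftrightarrow>
     p - q \<in> tensor_relations f g" (is "?L = ?R \<longleftrightarrow> _")
proof
  have "p \<in> ?L" by (simp add: mem_tensor_class_iff)
  moreover assume "?L = ?R"
  ultimately show "p - q \<in> tensor_relations f g" by (simp add: mem_tensor_class_iff)
next
  assume pq: "p - q \<in> tensor_relations f g"
  have "x - p \<in> tensor_relations f g \<longleftrightarrow> x - q \<in> tensor_relations f g" for x
    using tensor_relations_add[of "x - p" f g "p - q"] tensor_relations_diff[of "x - q" f g "p - q"] pq
    by auto
  then show "?L = ?R"
    by (auto simp: mem_tensor_class_iff)
qed

lemma pure_tensor_eqI: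
  "frag_of (a, b) - frag_of (a', b') \<in> tensor_relations f g \<Longrightarrow>
     pure_tensor f g a b = pure_tensor f g a' b'"
  by (simp add: pure_tensor_def tensor_class_eq_iff)

section \<open>Tensor products over central structure maps\<close>

locale central_algebras =
  fixes f :: "'c \<Rightarrow> 'a::ring_1" and g :: "'c \<Rightarrow> 'b::ring_1"
  assumes f_central: "f c * a = a * f c" and g_central: "g c * b = b * g c"
begin

text \<open>Additive relators stay additive relators by distributivity. In a scalar relator the
  scalar has to move past the new factor, which is where centrality of both images enters.\<close>

lemma pair_mult_relator:
  assumes "r \<in> tensor_relators f g"
  shows "frag_of (x, y) \<otimes>\<^bsub>pair_ring\<^esub> r \<in> tensor_relators f g \<and>
    r \<otimes>\<^bsub>pair_ring\<^esub> frag_of (x, y) \<in> tensor_relators f g"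
  using assms
proof (cases rule: tensor_relators_cases)
  case (scalar a c b)
  have "y * (g c * b) = g c * (y * b)" and "a * f c * x = (a * x) * f c"
    by (metis g_central mult.assoc) (metis f_central mult.assoc)
  then show ?thesis
    using tensor_relatorsI(3)[of "x * a" f c "y * b" g] tensor_relatorsI(3)[of "a * x" f c "b * y" g]
    by (simp add: scalar mult.assoc)
qed (simp_all add: distrib_left distrib_right tensor_relatorsI)

lemma ideal_tensor_relations: "ideal (tensor_relations f g) pair_ring"
proof -
  let ?I = "tensor_relations f g"
  \<comment> \<open>\<open>?S\<close> collects the elements that every formal sum multiplies into
    \<open>?I\<close> from both sides. It is closed under differences, so it suffices that it
    contains the relators; there the multiplier is reduced to pairs by induction.\<close>
  let ?S = "{r. \<forall>p. p \<otimes>\<^bsub>pair_ring\<^esub> r \<in> ?I \<and> r \<otimes>\<^bsub>pair_ring\<^esub> p \<in> ?I}"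
  have "?I \<subseteq> ?S"
  proof (rule tensor_relations_subset)
    show "tensor_relators f g \<subseteq> ?S"
    proof safe
      fix r p assume r: "r \<in> tensor_relators f g"
      show "p \<otimes>\<^bsub>pair_ring\<^esub> r \<in> ?I" "r \<otimes>\<^bsub>pair_ring\<^esub> p \<in> ?I"
        using pair_mult_relator[OF r] tensor_relators_subset_relations[of f g]
        by (induction p rule: formal_sum_induct) (auto intro: tensor_relations_diff)
    qed
  qed (auto intro: tensor_relations_diff)
  then show ?thesis
    by (intro idealI ring_pair_ring subgroup_tensor_relations) auto
qed

lemma pure_tensor_closed [simp]: "pure_tensor f g a b \<in> carrier (tensor_ring f g)"
  using ring_hom_closed[OF ideal.rcos_ring_hom[OF ideal_tensor_relations]]
  by (simp add: pure_tensor_def tensor_ring_def)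

lemma pure_tensor_mult [simp]:
  "pure_tensor f g a b \<otimes>\<^bsub>tensor_ring f g\<^esub> pure_tensor f g a' b' = pure_tensor f g (a * a') (b * b')"
  using ring_hom_mult[OF ideal.rcos_ring_hom[OF ideal_tensor_relations], of "frag_of (a, b)" "frag_of (a', b')"]
  by (simp add: pure_tensor_def tensor_ring_def)

lemma pure_tensor_add_left:
  "pure_tensor f g (a + a') b = pure_tensor f g a b \<oplus>\<^bsub>tensor_ring f g\<^esub> pure_tensor f g a' b"
proof -
  have "frag_of (a + a', b) - (frag_of (a, b) + frag_of (a', b)) \<in> tensor_relations f g"
    using subsetD[OF tensor_relators_subset_relations tensor_relatorsI(1)] by (simp add: algebra_simps)
  then show ?thesis
    using ring_hom_add[OF ideal.rcos_ring_hom[OF ideal_tensor_relations], of "frag_of (a, b)" "frag_of (a', b)"]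
    by (simp add: pure_tensor_def tensor_ring_def tensor_class_eq_iff[symmetric])
qed

end

section \<open>Scalars and induced maps\<close>

lemma tensor_ring_one: "\<one>\<^bsub>tensor_ring f g\<^esub> = pure_tensor f g 1 1"
  by (simp add: tensor_ring_def FactRing_def pure_tensor_def)

lemma pure_tensor_scalar: "pure_tensor f g (a * f c) b = pure_tensor f g a (g c * b)"
  by (intro pure_tensor_eqI subsetD[OF tensor_relators_subset_relations] tensor_relatorsI)

text \<open>An additive map compatible with scalars carries relators to relators, so all
  representatives of a class yield the same class. Only linearity of \<open>u\<close> matters, so
  the lemma covers the anti-automorphism \<alpha> and the single matrix entries of a
  splitting.\<close>

lemma tensor_map_pure:
  assumes u_add: "\<And>a a'. u (a + a') = u a + u a'"
    and u_scalar: "\<And>a c. u (a * f c) = u a * f' c"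
  shows "tensor_map f' g u (pure_tensor f g a b) = pure_tensor f' g (u a) b"
proof -
  let ?U = "frag_extend (\<lambda>(a, b). frag_of (u a, b))"
  have "tensor_relations f g \<subseteq> {p. ?U p \<in> tensor_relations f' g}"
  proof (rule tensor_relations_subset)
    have "tensor_relators f g \<subseteq> {p. ?U p \<in> tensor_relators f' g}"
      by (auto elim!: tensor_relators_cases simp: frag_extend_diff u_add u_scalar tensor_relatorsI)
    then show "tensor_relators f g \<subseteq> {p. ?U p \<in> tensor_relations f' g}"
      using tensor_relators_subset_relations by blast
  qed (auto simp: frag_extend_diff intro: tensor_relations_diff)
  then have U: "?U p - ?U q \<in> tensor_relations f' g" if "p - q \<in> tensor_relations f g" for p q
    using that by (auto simp: frag_extend_diff[symmetric])
  have "tensor_relations f' g +>\<^bsub>pair_ring\<^esub> ?U p = pure_tensor f' g (u a) b"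
    if "p \<in> pure_tensor f g a b" for p
    using U[of p "frag_of (a, b)"] that
    by (simp add: pure_tensor_def mem_tensor_class_iff tensor_class_eq_iff)
  \<comment> \<open>The class is nonempty, so the union in \<open>tensor_map\<close> is the common
    coset and not the empty set.\<close>
  moreover have "frag_of (a, b) \<in> pure_tensor f g a b"
    by (simp add: pure_tensor_def mem_tensor_class_iff)
  ultimately show ?thesis
    unfolding tensor_map_def by blast
qed

section \<open>Injectivity of base change\<close>

lemma type_hom_simps:
  assumes "type_hom f"
  shows "f (x + y) = f x + f y" "f (x * y) = f x * f y" "f 1 = 1" "f 0 = 0"
proof -
  show add: "f (x + y) = f x + f y" for x y
    using assms ring_hom_add[of f ring_of_type_algebra ring_of_type_algebra x y]
    by (simp add: type_hom_def ring_of_type_algebra_def)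
  show "f (x * y) = f x * f y"
    using assms ring_hom_mult[of f ring_of_type_algebra ring_of_type_algebra x y]
    by (simp add: type_hom_def ring_of_type_algebra_def)
  show "f 1 = 1"
    using assms ring_hom_one[of f ring_of_type_algebra ring_of_type_algebra]
    by (simp add: type_hom_def ring_of_type_algebra_def)
  show "f 0 = 0"
    using add[of 0 0] by simp
qed

text \<open>An \<open>F\<close>-linear retraction \<open>l\<close> of \<open>F \<rightarrow> K\<close> gives a retraction \<open>a \<otimes> b \<mapsto> a l(b)\<close> of
  \<open>A \<rightarrow> A \<otimes>\<^sub>F K\<close>, so the latter map is injective.\<close>

lemma field_extension_retraction:
  fixes j :: "'c::field \<Rightarrow> 'k::field"
  assumes j: "type_hom j"
  obtains l where "\<And>x y. l (x + y) = l x + l y" "\<And>c x. l (j c * x) = c * l x" "l 1 = 1"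
proof -
  interpret vector_space_pair "\<lambda>c x. j c * x" "(*) :: 'c \<Rightarrow> 'c \<Rightarrow> 'c"
    by unfold_locales (simp_all add: algebra_simps type_hom_simps[OF j])
  \<comment> \<open>Since 1 is nonzero, it is part of an F-basis of K, and a functional with value 1
    there exists.\<close>
  have "vs1.independent {1}"
    by simp
  from linear_independent_extend[OF this, of "\<lambda>_. 1"] obtain l
    where l: "Vector_Spaces.linear (\<lambda>c x. j c * x) (*) l" "l 1 = 1" by blast
  interpret l: Vector_Spaces.linear "\<lambda>c x. j c * x" "(*)" l by (rule l)
  show thesis
    using that l.add l.scale l(2) by blast
qed

lemma pure_tensor_one_inj:
  fixes f :: "'c::field \<Rightarrow> 'a::ring_1" and j :: "'c \<Rightarrow> 'k::field"
  assumes f: "type_hom f" and j: "type_hom j"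
    and eq: "pure_tensor f j x 1 = pure_tensor f j y 1"
  shows "x = y"
proof -
  obtain l where l: "\<And>x y. l (x + y) = l x + l y" "\<And>c x. l (j c * x) = c * l x" "l 1 = 1"
    using field_extension_retraction[OF j] by metis
  \<comment> \<open>\<open>m\<close> is the retraction on pairs and \<open>L\<close> its additive
    extension to formal sums. The values lie in the algebra itself, hence the explicit sum over the
    support.\<close>
  define m where "m = (\<lambda>(a, b). a * f (l b))"
  define L where "L p = (\<Sum>i\<in>Poly_Mapping.keys p. of_int (Poly_Mapping.lookup p i) * m i)" for p
  \<comment> \<open>Cancellation can shrink the support of a difference, so sums are compared over a
    common finite superset, where the additional coefficients are 0.\<close>
  have L_superset: "L p = (\<Sum>i\<in>S. of_int (Poly_Mapping.lookup p i) * m i)"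
    if "finite S" "Poly_Mapping.keys p \<subseteq> S" for p S
    unfolding L_def by (rule sum.mono_neutral_left) (use that in \<open>auto simp: in_keys_iff\<close>)
  have L_diff: "L (p - q) = L p - L q" for p q
  proof -
    let ?S = "Poly_Mapping.keys p \<union> Poly_Mapping.keys q"
    have "Poly_Mapping.keys (p - q) \<subseteq> ?S"
      by (rule keys_diff)
    then show ?thesis
      by (simp add: L_superset[of ?S] lookup_minus algebra_simps sum_subtractf)
  qed
  have L_of: "L (frag_of i) = m i" for i
    by (simp add: L_def)
  have "tensor_relations f j \<subseteq> {p. L p = 0}"
  proof (rule tensor_relations_subset)
    \<comment> \<open>On a scalar relator both pairs have the value
      \<open>a * f c * f (l b)\<close>, by linearity of \<open>l\<close> and multiplicativity of
      \<open>f\<close>.\<close>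
    show "tensor_relators f j \<subseteq> {p. L p = 0}"
      by (auto elim!: tensor_relators_cases
          simp: L_diff L_of m_def l type_hom_simps[OF f] distrib_left distrib_right mult.assoc)
  qed (simp_all add: L_diff, simp add: L_def)
  moreover have "frag_of (x, 1) - frag_of (y, 1) \<in> tensor_relations f j"
    using eq by (simp add: pure_tensor_def tensor_class_eq_iff)
  ultimately show "x = y"
    by (auto simp: L_diff L_of m_def l type_hom_simps[OF f])
qed

section \<open>Reduced norms and unitary groups\<close>

lemma ring_of_type_algebra_simps [simp]:
  "carrier ring_of_type_algebra = UNIV" "\<one>\<^bsub>ring_of_type_algebra\<^esub> = 1"
  "\<zero>\<^bsub>ring_of_type_algebra\<^esub> = 0" "x \<oplus>\<^bsub>ring_of_type_algebra\<^esub> y = x + y"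
  "x \<otimes>\<^bsub>ring_of_type_algebra\<^esub> y = x * y"
  by (simp_all add: ring_of_type_algebra_def)

lemma finsum_type_algebra:
  fixes t :: "'i \<Rightarrow> 'a::comm_ring_1"
  assumes "finite A"
  shows "finsum ring_of_type_algebra t A = sum t A"
proof -
  interpret cring "ring_of_type_algebra :: 'a ring" by (rule cring_from_type_algebra)
  show ?thesis using assms by induction simp_all
qed

lemma finprod_type_algebra:
  fixes t :: "'i \<Rightarrow> 'a::comm_ring_1"
  assumes "finite A"
  shows "finprod ring_of_type_algebra t A = prod t A"
proof -
  interpret cring "ring_of_type_algebra :: 'a ring" by (rule cring_from_type_algebra)
  show ?thesis using assms by induction simp_all
qed

text \<open>The determinant is an integer polynomial in the entries, so it commutes with
  homomorphisms of commutative rings. This links \<open>det\<close> on a type with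
  \<open>ring_det\<close> on a carrier.\<close>

lemma ring_det_hom:
  fixes A :: "'a::comm_ring_1^3^3"
  assumes "ring_hom_cring ring_of_type_algebra S t"
  shows "ring_det S (\<lambda>r s. t (A $ r $ s)) = t (det A)"
proof -
  interpret t: ring_hom_cring ring_of_type_algebra S t by fact
  have minus: "t (- x) = \<ominus>\<^bsub>S\<^esub> t x" for x
    using t.S.minus_equality[of "t (- x)" "t x"] t.hom_add[of "- x" x] t.hom_zero by simp
  \<comment> \<open>A sign is 1 or -1, so \<open>add_pow\<close> with it is either the identity or
    the additive inverse.\<close>
  have "add_pow S (sign p) (finprod S (\<lambda>i. t (A $ i $ p i)) UNIV) =
      t (of_int (sign p) * (\<Prod>i\<in>UNIV. A $ i $ p i))" for p
  proof -
    have "finprod S (\<lambda>i. t (A $ i $ p i)) UNIV = t (\<Prod>i\<in>UNIV. A $ i $ p i)"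
      using t.hom_finprod[of "\<lambda>i. A $ i $ p i" UNIV] by (simp add: finprod_type_algebra o_def)
    then show ?thesis
      by (cases p rule: sign_cases) (simp_all add: minus t.S.add.int_pow_neg)
  qed
  then have "ring_det S (\<lambda>r s. t (A $ r $ s)) =
      finsum S (\<lambda>p. t (of_int (sign p) * (\<Prod>i\<in>UNIV. A $ i $ p i))) {p. p permutes UNIV}"
    by (simp add: ring_det_def)
  also have "\<dots> = t (det A)"
    using t.hom_finsum[of "\<lambda>p. of_int (sign p) * (\<Prod>i\<in>UNIV. A $ i $ p i)" "{p. p permutes UNIV}"]
    by (simp add: finsum_type_algebra det_def o_def)
  finally show ?thesis .
qed

text \<open>Used with the algebraic closure of E on the left: it is the homomorphism along which the
  determinant of a split matrix is carried into the local tensor ring.\<close>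

lemma pure_tensor_one_hom:
  fixes f :: "'c \<Rightarrow> 'a::comm_ring_1" and g :: "'c \<Rightarrow> 'b::comm_ring_1"
  shows "ring_hom_cring ring_of_type_algebra (tensor_ring f g) (\<lambda>a. pure_tensor f g a 1)"
proof -
  interpret central_algebras f g by unfold_locales (simp_all add: mult.commute)
  have "cring (tensor_ring f g)"
    unfolding tensor_ring_def
    by (rule ideal.quotient_is_cring[OF ideal_tensor_relations cring_pair_ring])
  then show ?thesis
    by (intro ring_hom_cring.intro ring_hom_cring_axioms.intro cring_from_type_algebra ring_hom_memI)
      (simp_all add: pure_tensor_add_left tensor_ring_one)
qed

section \<open>Splittings and the reduced norm\<close>

lemma central_division_algebraD:
  assumes "central_division_algebra n \<kappa>"
  shows "type_hom \<kappa>" "\<kappa> e * d = d * \<kappa> e"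
proof -
  show "type_hom \<kappa>"
    using assms by (simp add: central_division_algebra_def)
  have "\<kappa> e \<in> {z. \<forall>x. z * x = x * z}"
    using assms rangeI[of \<kappa> e] by (simp add: central_division_algebra_def)
  then show "\<kappa> e * d = d * \<kappa> e"
    by simp
qed

lemma mat_ring_simps [simp]:
  "A \<oplus>\<^bsub>mat_ring\<^esub> B = A + B" "A \<otimes>\<^bsub>mat_ring\<^esub> B = A ** B"
  by (simp_all add: mat_ring_def)

lemma split_rep_simps:
  assumes \<kappa>: "central_division_algebra 3 \<kappa>" and h: "splitting \<kappa> h"
  shows "split_rep \<kappa> h (x + y) = split_rep \<kappa> h x + split_rep \<kappa> h y"
    and "split_rep \<kappa> h (x * y) = split_rep \<kappa> h x ** split_rep \<kappa> h y"
    and "split_rep \<kappa> h (\<kappa> e) = mat (to_ac e)"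
proof -
  interpret central_algebras \<kappa> to_ac
    by unfold_locales (simp_all add: central_division_algebraD[OF \<kappa>] mult.commute)
  have hom: "h \<in> ring_hom (tensor_ring \<kappa> to_ac) mat_ring"
    using h by (simp add: splitting_def ring_iso_def)
  show "split_rep \<kappa> h (x + y) = split_rep \<kappa> h x + split_rep \<kappa> h y"
    using ring_hom_add[OF hom] by (simp add: split_rep_def pure_tensor_add_left)
  show "split_rep \<kappa> h (x * y) = split_rep \<kappa> h x ** split_rep \<kappa> h y"
    using ring_hom_mult[OF hom, of "pure_tensor \<kappa> to_ac x 1" "pure_tensor \<kappa> to_ac y 1"]
    by (simp add: split_rep_def)
  \<comment> \<open>The scalar crosses the tensor sign, and a splitting sends
    \<open>1 \<otimes> c\<close> to the scalar matrix of \<open>c\<close>.\<close>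
  have "pure_tensor \<kappa> to_ac (\<kappa> e) 1 = pure_tensor \<kappa> to_ac 1 (to_ac e)"
    using pure_tensor_scalar[of \<kappa> to_ac 1 e 1] by simp
  then show "split_rep \<kappa> h (\<kappa> e) = mat (to_ac e)"
    using h by (simp add: split_rep_def splitting_def)
qed

lemma split_rep_one:
  assumes "central_division_algebra 3 \<kappa>" "splitting \<kappa> h"
  shows "split_rep \<kappa> h 1 = mat 1"
proof -
  have "\<kappa> 1 = 1"
    by (rule type_hom_simps(3)[OF central_division_algebraD(1)[OF assms(1)]])
  with split_rep_simps(3)[OF assms, of 1] show ?thesis
    by simp
qed

lemma det_uminus_3: "det (- A) = - det (A :: 'a::comm_ring_1^3^3)"
  by (simp add: det_3 algebra_simps)

lemma not_has_reduced_norm_minus_one: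
  fixes \<kappa> :: "'e::field_char_0 \<Rightarrow> 'd::division_ring"
  assumes \<kappa>: "central_division_algebra 3 \<kappa>"
  shows "\<not> has_reduced_norm \<kappa> (- 1) 1"
proof
  assume "has_reduced_norm \<kappa> (- 1) 1"
  then obtain h where h: "splitting \<kappa> h" and det: "det (split_rep \<kappa> h (- 1)) = 1"
    by (auto simp: has_reduced_norm_def)
  have "split_rep \<kappa> h 0 = 0"
    using split_rep_simps(1)[OF \<kappa> h, of 0 0] by simp
  then have "split_rep \<kappa> h (- 1) = - mat 1"
    using split_rep_simps(1)[OF \<kappa> h, of "- 1" 1] by (simp add: split_rep_one[OF \<kappa> h] eq_neg_iff_add_eq_0)
  then have "to_ac (- 1 :: 'e) = to_ac 1"
    using det by (simp add: det_uminus_3)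
  \<comment> \<open>\<open>to_ac\<close> is injective and E has characteristic zero, so -1 and 1
    stay distinct.\<close>
  then show False
    unfolding to_ac_eq_iff by simp
qed

section \<open>The global unitary group inside the local one\<close>

lemma SU_global_one_square:
  assumes \<kappa>: "central_division_algebra 3 \<kappa>" and \<alpha>: "involution_second_kind \<iota> \<kappa> \<alpha>"
    and g: "g \<in> SU_global \<kappa> \<alpha>"
  shows "1 \<in> SU_global \<kappa> \<alpha>" "g * g \<in> SU_global \<kappa> \<alpha>"
proof -
  \<comment> \<open>The splitting \<open>h\<close> that witnesses the norm of \<open>g\<close> also
    serves for \<open>1\<close> and \<open>g * g\<close>, by multiplicativity of \<open>det\<close>.
    Thus no comparison of different splittings by Skolem--Noether enters.\<close>
  obtain h where h: "splitting \<kappa> h" "det (split_rep \<kappa> h g) = 1" and "g \<noteq> 0" "\<alpha> g * g = 1"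
    using g by (auto simp: SU_global_def has_reduced_norm_def)
  \<comment> \<open>Since \<alpha> reverses products, the inner \<open>\<alpha> g * g\<close>
    cancels first.\<close>
  moreover have "\<alpha> (g * g) * (g * g) = \<alpha> g * (\<alpha> g * g) * g"
    using \<alpha> by (simp add: involution_second_kind_def mult.assoc)
  ultimately show "1 \<in> SU_global \<kappa> \<alpha>" "g * g \<in> SU_global \<kappa> \<alpha>"
    using \<alpha> by (auto simp: SU_global_def has_reduced_norm_def involution_second_kind_def
        split_rep_simps[OF \<kappa> h(1)] split_rep_one[OF \<kappa> h(1)] det_mul intro!: exI[of _ h])
qed

text \<open>Each of the three conditions is transported along
  \<open>d \<mapsto> d \<otimes> 1\<close>: the inverse comes from \<open>inverse g\<close>, the
  involution acts on the left factor, and the local norm is computed with the splitting that gives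
  the global one.\<close>

lemma pure_tensor_in_SU_local:
  fixes \<iota> :: "'f::field \<Rightarrow> 'e::field" and \<kappa> :: "'e \<Rightarrow> 'd::division_ring" and j :: "'f \<Rightarrow> 'k::field"
  assumes \<kappa>: "central_division_algebra 3 \<kappa>" and \<alpha>: "involution_second_kind \<iota> \<kappa> \<alpha>"
    and g: "g \<in> SU_global \<kappa> \<alpha>"
  shows "pure_tensor (\<kappa> \<circ> \<iota>) j g 1 \<in> carrier (SU_local \<iota> \<kappa> \<alpha> j)"
proof -
  interpret central_algebras "\<kappa> \<circ> \<iota>" j
    by unfold_locales (simp_all add: central_division_algebraD[OF \<kappa>] mult.commute)
  obtain h where h: "splitting \<kappa> h" "det (split_rep \<kappa> h g) = 1" and g0: "g \<noteq> 0" "\<alpha> g * g = 1"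
    using g by (auto simp: SU_global_def has_reduced_norm_def)
  \<comment> \<open>\<tau> fixes F, so \<alpha>, which is only semilinear over E, is linear over F
    and induces a map on the tensor product over F.\<close>
  obtain \<tau> where \<tau>: "\<And>x. \<tau> (\<iota> x) = \<iota> x" "\<And>x. \<alpha> (\<kappa> x) = \<kappa> (\<tau> x)"
    using \<alpha> by (auto simp: involution_second_kind_def Gal_def)
  have unit: "pure_tensor (\<kappa> \<circ> \<iota>) j g 1 \<in> Units (local_algebra \<iota> \<kappa> j)"
    unfolding Units_def local_algebra_def
    by (auto simp: tensor_ring_one g0 intro!: bexI[of _ "pure_tensor (\<kappa> \<circ> \<iota>) j (inverse g) 1"])
  have "\<alpha> (a * (\<kappa> \<circ> \<iota>) c) = \<alpha> a * (\<kappa> \<circ> \<iota>) c" for a c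
    using \<alpha> by (simp add: involution_second_kind_def \<tau> central_division_algebraD(2)[OF \<kappa>])
  then have involution: "local_involution \<iota> \<kappa> \<alpha> j (pure_tensor (\<kappa> \<circ> \<iota>) j g 1) =
      pure_tensor (\<kappa> \<circ> \<iota>) j (\<alpha> g) 1"
    unfolding local_involution_def
    by (intro tensor_map_pure) (use \<alpha> in \<open>simp_all add: involution_second_kind_def\<close>)
  \<comment> \<open>A scalar matrix on the right multiplies every entry, so each entry of the split
    matrix is an F-linear function on D.\<close>
  have "split_rep \<kappa> h (a * (\<kappa> \<circ> \<iota>) c) $ r $ s = split_rep \<kappa> h a $ r $ s * (to_ac \<circ> \<iota>) c" for a c r s
    by (simp add: split_rep_simps[OF \<kappa> h(1)] matrix_matrix_mult_def mat_def sum.delta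
        if_distrib[of "\<lambda>x. _ * x"] cong: if_cong)
  then have "tensor_map (to_ac \<circ> \<iota>) j (\<lambda>d. split_rep \<kappa> h d $ r $ s) (pure_tensor (\<kappa> \<circ> \<iota>) j g 1) =
      pure_tensor (to_ac \<circ> \<iota>) j (split_rep \<kappa> h g $ r $ s) 1" for r s
    by (intro tensor_map_pure) (simp_all add: split_rep_simps[OF \<kappa> h(1)])
  moreover have "tensor_map (to_ac \<circ> \<iota>) j to_ac (pure_tensor \<iota> j 1 1) = pure_tensor (to_ac \<circ> \<iota>) j (to_ac 1) 1"
    by (rule tensor_map_pure) simp_all
  \<comment> \<open>\<open>ring_det_hom\<close> turns the local determinant into the pure tensor of
    \<open>det (split_rep \<kappa> h g)\<close> and 1, and this \<open>det\<close> is 1 by the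
    choice of \<open>h\<close>.\<close>
  ultimately have "has_local_reduced_norm \<iota> \<kappa> j (pure_tensor (\<kappa> \<circ> \<iota>) j g 1) \<one>\<^bsub>tensor_ring \<iota> j\<^esub>"
    unfolding has_local_reduced_norm_def
    using h ring_det_hom[OF pure_tensor_one_hom[of "to_ac \<circ> \<iota>" j], of "split_rep \<kappa> h g"]
    by (auto simp: tensor_ring_one intro!: exI[of _ h])
  then show ?thesis
    using unit by (simp add: SU_local_def involution) (simp add: local_algebra_def tensor_ring_one g0)
qed

lemma SU_global_image_square_one:
  fixes \<iota> :: "'f::field_char_0 \<Rightarrow> 'e::field_char_0" and \<kappa> :: "'e \<Rightarrow> 'd::division_ring"
    and j :: "'f \<Rightarrow> 'k::field"
  assumes \<iota>: "type_hom \<iota>" and j: "type_hom j" and \<kappa>: "central_division_algebra 3 \<kappa>"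
    and \<alpha>: "involution_second_kind \<iota> \<kappa> \<alpha>" and \<phi>: "\<phi> \<in> iso (SU_local \<iota> \<kappa> \<alpha> j) (SU3 H)"
    and R: "R \<in> \<phi> ` SU_global_in_local \<iota> \<kappa> \<alpha> j" "R ** R = mat 1"
  shows "R = mat 1"
proof -
  interpret central_algebras "\<kappa> \<circ> \<iota>" j
    by unfold_locales (simp_all add: central_division_algebraD[OF \<kappa>] mult.commute)
  let ?t = "\<lambda>g. pure_tensor (\<kappa> \<circ> \<iota>) j g 1"
  obtain g where g: "g \<in> SU_global \<kappa> \<alpha>" and R_eq: "R = \<phi> (?t g)"
    using R(1) by (auto simp: SU_global_in_local_def)
  note in_local = pure_tensor_in_SU_local[OF \<kappa> \<alpha>, where j = j]
  note SU = g SU_global_one_square[OF \<kappa> \<alpha> g]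
  have \<phi>_mult: "\<phi> (?t (x * y)) = \<phi> (?t x) ** \<phi> (?t y)"
    if "x \<in> SU_global \<kappa> \<alpha>" "y \<in> SU_global \<kappa> \<alpha>" for x y
    using hom_mult[of \<phi> "SU_local \<iota> \<kappa> \<alpha> j" "SU3 H" "?t x" "?t y"] \<phi> in_local that
    by (simp add: iso_def SU_local_def SU3_def local_algebra_def)
  have inj: "inj_on \<phi> (carrier (SU_local \<iota> \<kappa> \<alpha> j))"
    using \<phi> by (simp add: iso_def bij_betw_def)
  \<comment> \<open>An invertible idempotent matrix is the identity. This gives the value of \<phi>
    at the unit from multiplicativity alone, without a group structure on
    \<open>SU_local\<close>.\<close>
  have "\<phi> (?t 1) \<in> carrier (SU3 H)"
    using \<phi> in_local SU(2) by (auto simp: iso_def hom_def)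
  then have "invertible (\<phi> (?t 1))"
    by (simp add: SU3_def invertible_det_nz)
  moreover have "\<phi> (?t 1) ** \<phi> (?t 1) = \<phi> (?t 1)"
    using \<phi>_mult[OF SU(2) SU(2)] by simp
  ultimately have \<phi>_one: "\<phi> (?t 1) = mat 1"
    by (metis invertible_def matrix_mul_assoc matrix_mul_lid)
  have "\<phi> (?t (g * g)) = \<phi> (?t 1)"
    using \<phi>_mult[OF g g] R(2) by (simp add: R_eq \<phi>_one)
  then have "?t (g * g) = ?t 1"
    using inj in_local SU by (auto dest: inj_onD)
  \<comment> \<open>The composite F -> E -> D is a unital homomorphism, so
    \<open>pure_tensor_one_inj\<close> lets the equation descend from the local algebra to
    D.\<close>
  moreover have "type_hom (\<kappa> \<circ> \<iota>)"
    using \<iota> central_division_algebraD(1)[OF \<kappa>]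
    unfolding type_hom_def using ring_hom_trans by blast
  ultimately have "g * g = 1"
    using pure_tensor_one_inj[OF _ j] by blast
  then have "g = 1 \<or> g = - 1"
    by (simp add: square_eq_1_iff)
  moreover have "g \<noteq> - 1"
    using g not_has_reduced_norm_minus_one[OF \<kappa>] by (auto simp: SU_global_def)
  ultimately show ?thesis
    by (simp add: R_eq \<phi>_one)
qed

section \<open>The adjoint involution and elements of square one\<close>

lemma matrix_inv_mult_self: "invertible A \<Longrightarrow> matrix_inv A ** A = mat 1"
  unfolding matrix_inv_def invertible_def by (rule someI2_ex) auto

text \<open>By associativity the product is \<open>matrix_inv H\<close> times
  \<open>conj_transpose g ** H ** g\<close>, and the latter is \<open>H\<close>.\<close>

lemma adjoint_involution_SU3:
  assumes "invertible H" "g \<in> carrier (SU3 H)"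
  shows "adjoint_involution H g ** g = mat 1"
  using assms by (simp add: adjoint_involution_def SU3_def matrix_mul_assoc[symmetric] matrix_inv_mult_self)

theorem corollary1p2:
  fixes H :: "complex^3^3"
    and \<iota> :: "'f::field_char_0 \<Rightarrow> 'e::field_char_0"
    and \<kappa> :: "'e \<Rightarrow> 'd::division_ring"
    and \<alpha> :: "'d \<Rightarrow> 'd"
    and v :: "'f \<Rightarrow> real"
    and j :: "'f \<Rightarrow> 'k::field"
    and w :: "'k \<Rightarrow> real"
    and \<phi> :: "('d, 'k) tensor \<Rightarrow> complex^3^3"
  assumes "hermitian_matrix H" and "invertible H"
    and "number_field TYPE('f)" and "number_field TYPE('e)"
    and "quadratic_extension \<iota>"
    and "central_division_algebra 3 \<kappa>"
    and "involution_second_kind \<iota> \<kappa> \<alpha>"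
    and "represents_infinite_place v"
    and "is_completion v j w"
    and "\<phi> \<in> iso (SU_local \<iota> \<kappa> \<alpha> j) (SU3 H)"
  shows "(\<forall>R \<in> carrier (SU3 H). is_reflection R \<longrightarrow> R \<notin> \<phi> ` SU_global_in_local \<iota> \<kappa> \<alpha> j) \<and>
         (\<forall>g \<in> carrier (SU3 H).
            (adjoint_involution H g = g \<or> adjoint_involution H g = - g) \<and> g \<noteq> mat 1 \<longrightarrow>
            g \<notin> \<phi> ` SU_global_in_local \<iota> \<kappa> \<alpha> j)"
proof -
  have "type_hom \<iota>" "type_hom j"
    using assms(5,9) by (simp_all add: quadratic_extension_def is_completion_def)
  then have square: "R = mat 1"
    if "R ** R = mat 1" "R \<in> \<phi> ` SU_global_in_local \<iota> \<kappa> \<alpha> j" for R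
    using SU_global_image_square_one[OF _ _ assms(6,7,10) that(2,1)] by blast
  have "g ** g = mat 1"
    if g: "g \<in> carrier (SU3 H)" and adj: "adjoint_involution H g = g \<or> adjoint_involution H g = - g" for g
  proof -
    have det: "det g = 1"
      using g by (simp add: SU3_def)
    have "adjoint_involution H g \<noteq> - g"
    proof
      assume "adjoint_involution H g = - g"
      then have "det (- g ** g) = det (mat 1 :: complex^3^3)"
        using adjoint_involution_SU3[OF assms(2) g] by simp
      then show False
        by (simp add: det_mul det_uminus_3 det)
    qed
    with adj show ?thesis
      using adjoint_involution_SU3[OF assms(2) g] by auto
  qed
  \<comment> \<open>Reflections have square 1 by definition, so \<open>square\<close> settles both
    claims.\<close>
  with square show ?thesis
    unfolding is_reflection_def by blast
qed

end
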